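(* For every connected graph $G$ of order at least $2$ and every positive integer $k$, $$\gamma_k(G)\le \dim_k(G)+1.$$
   Context: All graphs are finite, simple, undirected and connected. $d(x,y)$ is the length of a shortest path between $x$ and $y$ in $G$. For a positive integer $k$, let $d_k(x,y)=\min\{d(x,y),k+1\}$. A set $D\subseteq V(G)$ is a distance-$k$ dominating set of $G$ if for each $u\in V(G)\setminus D$ there is $w\in D$ with $d(u,w)\le k$; the distance-$k$ domination number $\gamma_k(G)$ is the minimum cardinality of a distance-$k$ dominating set. A set $S\subseteq V(G)$ is a distance-$k$ resolving set of $G$ if for any distinct $x,y\in V(G)$ there is $z\in S$ with $d_k(x,z)\ne d_k(y,z)$; the distance-$k$ dimension $\dim_k(G)$ is the minimum cardinality of a distance-$k$ resolving set. *)

theory Defs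
  imports "Graph_Theory.Graph_Theory"
begin

text \<open>
  A finite simple undirected graph is an instance of the locale \<^locale>\<open>graph\<close>: a finite
  symmetric digraph without loops or parallel arcs, in which every edge is represented by its
  two orientations.
\<close>

text \<open>Outside of connected pairs \<open>x\<close>, \<open>y\<close> the value is unspecified.\<close>
definition graph_dist :: "('a, 'b) pre_digraph \<Rightarrow> 'a \<Rightarrow> 'a \<Rightarrow> nat" where
  "graph_dist G x y = (LEAST n. \<exists>p. pre_digraph.apath G x p y \<and> length p = n)"

text \<open>
  On connected pairs this is the library's shortest path distance \<open>\<mu>\<close> for unit weights,
  as a natural number.
\<close>
lemma graph_dist_eq_mu:
  assumes "fin_digraph G" and reach: "x \<rightarrow>\<^sup>*\<^bsub>G\<^esub> y"
  shows "wf_digraph.\<mu> G (\<lambda>_. 1) x y = ereal (real (graph_dist G x y))"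
proof -
  interpret fin_digraph G by fact
  have cost: "awalk_cost (\<lambda>_. 1) p = real (length p)" for p
    by (induction p) auto
  obtain p where p: "apath x p y" and mu: "\<mu> (\<lambda>_. 1) x y = ereal (awalk_cost (\<lambda>_. 1) p)"
    using min_cost_awalk[OF reach, of "\<lambda>_. 1"] by auto
  have "graph_dist G x y = length p"
    unfolding graph_dist_def
  proof (rule Least_equality)
    show "\<exists>q. apath x q y \<and> length q = length p" using p by blast
  next
    fix n assume "\<exists>q. apath x q y \<and> length q = n"
    then obtain q where q: "apath x q y" "length q = n" by blast
    have "\<mu> (\<lambda>_. 1) x y \<le> ereal (awalk_cost (\<lambda>_. 1) q)"
      by (rule min_cost_le_walk_cost) (use q in \<open>auto simp: apath_def\<close>)
    then show "length p \<le> n" using mu q by (simp add: cost)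
  qed
  then show ?thesis using mu by (simp add: cost)
qed

definition trunc_dist :: "('a, 'b) pre_digraph \<Rightarrow> nat \<Rightarrow> 'a \<Rightarrow> 'a \<Rightarrow> nat" where
  "trunc_dist G k x y = min (graph_dist G x y) (k + 1)"

definition distance_dominating_set :: "('a, 'b) pre_digraph \<Rightarrow> nat \<Rightarrow> 'a set \<Rightarrow> bool" where
  "distance_dominating_set G k D \<longleftrightarrow>
     D \<subseteq> verts G \<and> (\<forall>u \<in> verts G - D. \<exists>w \<in> D. graph_dist G u w \<le> k)"

definition distance_domination_number :: "('a, 'b) pre_digraph \<Rightarrow> nat \<Rightarrow> nat" where
  "distance_domination_number G k = (LEAST n. \<exists>D. distance_dominating_set G k D \<and> card D = n)"

definition distance_resolving_set :: "('a, 'b) pre_digraph \<Rightarrow> nat \<Rightarrow> 'a set \<Rightarrow> bool" where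
  "distance_resolving_set G k S \<longleftrightarrow>
     S \<subseteq> verts G \<and>
     (\<forall>x \<in> verts G. \<forall>y \<in> verts G. x \<noteq> y \<longrightarrow>
        (\<exists>z \<in> S. trunc_dist G k x z \<noteq> trunc_dist G k y z))"

definition distance_dimension :: "('a, 'b) pre_digraph \<Rightarrow> nat \<Rightarrow> nat" where
  "distance_dimension G k = (LEAST n. \<exists>S. distance_resolving_set G k S \<and> card S = n)"

end

theory Submission
  imports Defs
begin

text \<open>
  Every vertex at distance more than \<open>k\<close> from all of a distance-\<open>k\<close> resolving set \<open>S\<close> has
  truncated distance \<open>k + 1\<close> to each element of \<open>S\<close>, so there is at most one such vertex, and
  adding it to \<open>S\<close> gives a distance-\<open>k\<close> dominating set.
\<close>

text \<open>Reachability supplies a path, so the \<open>LEAST\<close> is attained; a path of length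
  0 is empty and its ends coincide.\<close>

lemma (in wf_digraph) graph_dist_eq_0_iff:
  assumes "x \<rightarrow>\<^sup>* y"
  shows "graph_dist G x y = 0 \<longleftrightarrow> x = y"
proof -
  have "\<exists>n p. apath x p y \<and> length p = n"
    using assms by (simp add: reachable_apath)
  then have "\<exists>p. apath x p y \<and> length p = graph_dist G x y"
    unfolding graph_dist_def by (rule LeastI_ex)
  then show ?thesis
    using assms by (auto simp: apath_Nil_iff graph_dist_def reachable_in_verts intro!: Least_equality)
qed

text \<open>Connectedness is needed here: \<open>graph_dist\<close> is unspecified on unreachable pairs.\<close>
lemma distance_resolving_set_verts:
  assumes "graph G" and "Digraph_Component.connected G"
  shows "distance_resolving_set G k (verts G)"
proof -
  interpret graph G by fact
  \<comment> \<open>\<open>connected\<close> refers to the symmetric closure; symmetric arcs turn it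
    into directed reachability.\<close>
  have reach: "x \<rightarrow>\<^sup>*\<^bsub>G\<^esub> y" if "x \<in> verts G" "y \<in> verts G" for x y
    using symmetric_connected_imp_strongly_connected[OF sym_arcs assms(2)] that
    by (auto simp: strongly_connected_def)
  show ?thesis
    unfolding distance_resolving_set_def
  proof (intro conjI ballI impI)
    fix x y assume xy: "x \<in> verts G" "y \<in> verts G" "x \<noteq> y"
    then have "graph_dist G x x = 0" "graph_dist G y x \<noteq> 0"
      using reach by (simp_all add: graph_dist_eq_0_iff)
    \<comment> \<open>Truncation at \<open>k + 1 > 0\<close> keeps zero and nonzero distances
      apart.\<close>
    then have "trunc_dist G k x x \<noteq> trunc_dist G k y x"
      by (simp add: trunc_dist_def)
    then show "\<exists>z \<in> verts G. trunc_dist G k x z \<noteq> trunc_dist G k y z"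
      using xy by blast
  qed simp
qed

lemma distance_domination_number_le_card:
  assumes "distance_dominating_set G k D"
  shows "distance_domination_number G k \<le> card D"
  unfolding distance_domination_number_def using assms by (blast intro: Least_le)

lemma distance_domination_number_le_resolving:
  assumes "distance_resolving_set G k S"
  shows "distance_domination_number G k \<le> card S + 1"
proof -
  define U where "U = {u \<in> verts G. \<forall>w \<in> S. k < graph_dist G u w}"
  have "u = v" if "u \<in> U" "v \<in> U" for u v
  proof (rule ccontr)
    assume "u \<noteq> v"
    with that assms obtain z where "z \<in> S" "trunc_dist G k u z \<noteq> trunc_dist G k v z"
      unfolding distance_resolving_set_def U_def by blast
    moreover from this that have "k < graph_dist G u z" "k < graph_dist G v z"
      by (auto simp: U_def)
    ultimately show False by (simp add: trunc_dist_def)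
  qed
  then have "card U \<le> 1"
    \<comment> \<open>\<open>G\<close> is arbitrary here; an infinite \<open>U\<close> would have
      \<open>card U = 0\<close>.\<close>
    by (cases "finite U") (auto simp: card_le_Suc0_iff_eq)
  \<comment> \<open>A vertex outside \<open>U\<close> is within \<open>k\<close> of some element of
    \<open>S\<close>.\<close>
  moreover have "distance_dominating_set G k (S \<union> U)"
    using assms unfolding distance_resolving_set_def distance_dominating_set_def U_def
    by (fastforce simp: not_less)
  then have "distance_domination_number G k \<le> card (S \<union> U)"
    by (rule distance_domination_number_le_card)
  ultimately show ?thesis
    using card_Un_le[of S U] by linarith
qed

theorem proposition2p2:
  fixes G :: "('a, 'b) pre_digraph" and k :: nat
  assumes "graph G"
    and "Digraph_Component.connected G"
    and "card (verts G) \<ge> 2"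
    and "k \<ge> 1"
  shows "distance_domination_number G k \<le> distance_dimension G k + 1"
proof -
  \<comment> \<open>Some resolving set must exist for the \<open>LEAST\<close> in
    \<open>distance_dimension\<close> to be attained; \<open>verts G\<close> is one.\<close>
  have "\<exists>n S. distance_resolving_set G k S \<and> card S = n"
    using distance_resolving_set_verts[OF assms(1,2)] by blast
  then have "\<exists>S. distance_resolving_set G k S \<and> card S = distance_dimension G k"
    unfolding distance_dimension_def by (rule LeastI_ex)
  then obtain S where "distance_resolving_set G k S" "card S = distance_dimension G k"
    by blast
  then show ?thesis
    using distance_domination_number_le_resolving by metis
qed

end
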